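(* The $\ell_{0/1}$ loss, hinge loss, squared hinge loss and exponential loss are all given by the single parametric family $z\mapsto \exp_{q'}(-z)$, $z\in\mathbb{R}$, for specific values of $q'$. Precisely, for every $z\in\mathbb{R}$: \begin{itemize} \item ($q'=-\infty$, $\ell_{0/1}$ loss) $\displaystyle\lim_{q'\to-\infty}\exp_{q'}(-z)=I(z\le 0)$; \item ($q'=0$, hinge loss) $\exp_{0}(-z)=[1-z]_+$; \item ($q'=\tfrac12$, squared hinge loss up to scaling of $z$) $\exp_{1/2}(-z)=\left[1-\tfrac12 z\right]_+^2$; \item ($q'=1$, exponential loss) $\exp_{1}(-z)=\exp(-z)$, where $\exp_1(-z)$ is the limit of $\exp_{q'}(-z)$ as $q'\to1$. \end{itemize}
   Context: For $x\in\mathbb{R}$, $[x]_+=\max\{x,0\}$. For $q'\in\mathbb{R}\setminus\{1\}$ the $q'$-exponential is $\exp_{q'}x=[1+(1-q')x]_+^{\frac{1}{1-q'}}$, and $\exp_1 x=\lim_{q'\to1}\exp_{q'}x=\exp x$. Thus $\exp_{q'}(-z)=[1-(1-q')z]_+^{\frac{1}{1-q'}}$ for $q'\ne1$. $I(A)$ denotes the $0/1$ indicator: $I(A)=1$ if $A$ holds and $0$ otherwise. The value at $q'=-\infty$ is understood as the pointwise limit $q'\to-\infty$. *)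

theory Defs
  imports Complex_Main
begin

definition pos_part :: "real \<Rightarrow> real" where
  "pos_part x = max x 0"

text \<open>
  For \<open>q > 1\<close> the exponent is negative, and where the positive part vanishes (the pole of the
  \<open>q\<close>-exponential) \<open>powr\<close> returns \<open>0\<close>. This does not affect the limit \<open>q \<rightarrow> 1\<close>: for fixed \<open>x\<close>
  the base is positive for all \<open>q\<close> close to \<open>1\<close>.
\<close>
definition q_exp :: "real \<Rightarrow> real \<Rightarrow> real" where
  "q_exp q x =
    (if q = 1 then Lim (at 1) (\<lambda>r. pos_part (1 + (1 - r) * x) powr (1 / (1 - r)))
     else pos_part (1 + (1 - q) * x) powr (1 / (1 - q)))"

end

theory Submission
  imports Defs "HOL-Real_Asymp.Real_Asymp"
begin

text \<open>At q = 0 and q = 1/2 the exponent 1/(1 - q) is 1 and 2, so evaluation suffices. For q to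
  minus infinity put n = 1 - q: if z > 0, the base 1 - n z becomes negative and is truncated to 0;
  if z < 0, (1 + n |z|)^(1/n) tends to 1 because ln (1 + n |z|) / n tends to 0
  (\<open>q_exp_limit_at_bot\<close>). For q to 1 put h = 1 - q: this is Euler's limit (1 + h
  x)^(1/h) to exp x (\<open>pos_part_powr_tendsto_exp\<close>).\<close>

lemma q_exp_limit_at_bot:
  "((\<lambda>q. q_exp q (- z)) \<longlongrightarrow> of_bool (z \<le> 0)) at_bot"
proof -
  let ?f = "\<lambda>q. pos_part (1 + (1 - q) * (- z)) powr (1 / (1 - q))"
  have "\<forall>\<^sub>F q in at_bot. q_exp q (- z) = ?f q"
    using eventually_gt_at_bot[of 1] by eventually_elim (simp add: q_exp_def)
  moreover have "(?f \<longlongrightarrow> of_bool (z \<le> 0)) at_bot"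
  proof (cases "z \<le> 0")
    case True
    have "((\<lambda>q. (1 + (1 - q) * (- z)) powr (1 / (1 - q))) \<longlongrightarrow> 1) at_bot"
    \<comment> \<open>For z = 0 the base is constantly 1; for z < 0 it grows linearly in -q, which
      the (1/n)-th root flattens to 1.\<close>
    proof (cases "z = 0")
      case False
      with True have "z < 0" by simp
      then show ?thesis by real_asymp
    qed simp
    moreover have "\<forall>\<^sub>F q in at_bot. ?f q = (1 + (1 - q) * (- z)) powr (1 / (1 - q))"
      using eventually_le_at_bot[of 1]
    proof eventually_elim
      case (elim q)
      then have "0 \<le> (1 - q) * (- z)"
        using True by (intro mult_nonneg_nonneg) auto
      then show ?case by (simp add: pos_part_def)
    qed
    ultimately show ?thesis
      using True by (simp add: tendsto_cong)
  next
    case False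
    then have "\<forall>\<^sub>F q in at_bot. 1 + (1 - q) * (- z) < 0"
      by real_asymp
    \<comment> \<open>The truncated base is 0, and \<open>0 powr a = 0\<close>.\<close>
    then have "\<forall>\<^sub>F q in at_bot. ?f q = 0"
      by eventually_elim (simp add: pos_part_def)
    then show ?thesis
      using False by (simp add: tendsto_eventually)
  qed
  ultimately show ?thesis
    by (simp add: tendsto_cong)
qed

lemma pos_part_powr_tendsto_exp:
  "((\<lambda>r. pos_part (1 + (1 - r) * x) powr (1 / (1 - r))) \<longlongrightarrow> exp x) (at 1)"
proof -
  have "((\<lambda>r. (1 + (1 - r) * x) powr (1 / (1 - r))) \<longlongrightarrow> exp x) (at 1)"
    by real_asymp
  \<comment> \<open>The base tends to 1, so near r = 1 the truncation is inactive, on both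
    sides.\<close>
  moreover have "\<forall>\<^sub>F r in at 1. 0 < 1 + (1 - r) * x"
    by real_asymp
  then have "\<forall>\<^sub>F r in at 1. pos_part (1 + (1 - r) * x) powr (1 / (1 - r))
      = (1 + (1 - r) * x) powr (1 / (1 - r))"
    by eventually_elim (simp add: pos_part_def)
  ultimately show ?thesis
    by (simp add: tendsto_cong)
qed

text \<open>The \<open>Lim\<close> in the definition carries information only once convergence is
  proved.\<close>

lemma q_exp_1: "q_exp 1 x = exp x"
  by (simp add: q_exp_def tendsto_Lim pos_part_powr_tendsto_exp)

lemma q_exp_limit_at_1: "((\<lambda>q. q_exp q x) \<longlongrightarrow> q_exp 1 x) (at 1)"
proof -
  \<comment> \<open>\<open>at 1\<close> is punctured, so the branch q = 1 is never met.\<close>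
  have "\<forall>\<^sub>F q in at 1. q_exp q x = pos_part (1 + (1 - q) * x) powr (1 / (1 - q))"
    by (auto simp: eventually_at_filter q_exp_def)
  then show ?thesis
    using pos_part_powr_tendsto_exp[of x] by (simp add: q_exp_1 tendsto_cong)
qed

theorem theorem1:
  fixes z :: real
  shows "((\<lambda>q. q_exp q (- z)) \<longlongrightarrow> of_bool (z \<le> 0)) at_bot
    \<and> q_exp 0 (- z) = pos_part (1 - z)
    \<and> q_exp (1 / 2) (- z) = (pos_part (1 - z / 2))\<^sup>2
    \<and> ((\<lambda>q. q_exp q (- z)) \<longlongrightarrow> q_exp 1 (- z)) (at 1)
    \<and> q_exp 1 (- z) = exp (- z)"
proof (intro conjI)
  \<comment> \<open>Here and for q = 1/2, \<open>powr\<close> with exponent 1 or 2 is an ordinary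
    power because the positive part is nonnegative.\<close>
  show "q_exp 0 (- z) = pos_part (1 - z)"
    by (simp add: q_exp_def pos_part_def)
  show "q_exp (1 / 2) (- z) = (pos_part (1 - z / 2))\<^sup>2"
    by (simp add: q_exp_def pos_part_def)
qed (fact q_exp_limit_at_bot q_exp_limit_at_1 q_exp_1)+

end
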